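(* Let $\bar v,\bar q,\bar\kappa,\bar\mu>0$ and let $\mathcal{L}=\bar L_1\partial_x+\bar L_2\partial_x^2+\bar L_3\partial_x^3$ be the linearized Korteweg operator with symbols $A(\xi)$, $B(\xi)$ (all as given in the context). Then $\mathcal{L}$ is symbol symmetrizable but not Friedrichs symmetrizable. Moreover, every symbol symmetrizer of $\mathcal L$ has the form $$A_0(\xi)=\begin{pmatrix} a(\xi) & 0\\ 0 & a(\xi)\beta(\xi)^{-1}\end{pmatrix}\in C^\infty(\mathbb{R};\mathbb{R}^{2\times 2}),$$ where $$\beta(\xi):=\bar q+\xi^2\bar\kappa>0,\qquad \xi\in\mathbb{R},$$ and $a=a(\xi)\in C^\infty(\mathbb{R})$ is any smooth positive function uniformly bounded below, $a(\xi)\ge a_0>0$ for all $\xi\in\mathbb{R}$ (with $a_0$ a constant).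
   Context: The constants arise from linearizing the one-dimensional isothermal Navier–Stokes–Korteweg system in Lagrangian coordinates $v_t-u_x=0$, $u_t+p(v)_x=\big(\tfrac{\mu(v)}{v}u_x\big)_x-\big(\kappa(v)v_{xx}+\tfrac12\kappa'(v)v_x^2\big)_x$ about a constant equilibrium state $\bar U=(\bar v,\bar u)$ with $\bar v>0$ and $p'(\bar v)<0$, where $v$ is the specific volume, $u$ the velocity, and the pressure $p$, viscosity $\mu$ and capillarity $\kappa$ are smooth positive functions of $v$. Set $\bar q=-p'(\bar v)$, $\bar\kappa=\kappa(\bar v)$, $\bar\mu=\mu(\bar v)$, all positive. The linearized operator $\mathcal L=\sum_{j=1}^3\bar L_j\partial_x^j$ has coefficient matrices $$\bar L_1=\begin{pmatrix}0&1\\ \bar q&0\end{pmatrix},\quad \bar L_2=\begin{pmatrix}0&0\\0&\bar\mu/\bar v\end{pmatrix},\quad \bar L_3=-\begin{pmatrix}0&0\\ \bar\kappa&0\end{pmatrix}.$$ Taking the Fourier transform of $U_t=\mathcal L U$ gives $\hat U_t+i\xi A(\xi)\hat U+B(\xi)\hat U=0$ with $$A(\xi)=\begin{pmatrix}0&-1\\-(\bar q+\xi^2\bar\kappa)&0\end{pmatrix},\qquad B(\xi)=\xi^2\begin{pmatrix}0&0\\0&\bar\mu/\bar v\end{pmatrix}.$$ Definitions. (i) $\mathcal L$ is Friedrichs symmetrizable if, for any fixed but arbitrary state $\bar U$, there is a symmetric, positive definite matrix $\bar A_0=\bar A_0(\bar U)$ such that $\bar A_0\bar L_j$ is symmetric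 for every $j=1,2,3$. (ii) $\mathcal L$ is symbol symmetrizable if there is a smooth, symmetric, positive definite matrix-valued function $A_0=A_0(\xi)>0$ such that, for all $\xi\in\mathbb R$, both $A_0(\xi)A(\xi)$ and $A_0(\xi)B(\xi)$ are symmetric and $A_0(\xi)B(\xi)\ge 0$ is positive semi-definite; such an $A_0$ is called a symbol symmetrizer of $\mathcal L$.
   Formalization: Every symbol symmetrizer is shown to have the stated form with a smooth and pointwise positive; the uniform bound a ≥ a_0 > 0 is shown exactly for those A_0 bounded away from zero in norm, since a = 1/(1+ξ²) also gives a symbol symmetrizer. *)

theory Defs
  imports "HOL-Analysis.Analysis"
begin

definition smooth :: "(real \<Rightarrow> 'a::real_normed_vector) \<Rightarrow> bool" where
  "smooth f \<longleftrightarrow>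
     (\<forall>n x. ((\<lambda>g t. vector_derivative g (at t)) ^^ n) f differentiable (at x))"

definition symmetric :: "real^'n^'n \<Rightarrow> bool" where
  "symmetric M \<longleftrightarrow> transpose M = M"

definition pos_def :: "real^'n^'n \<Rightarrow> bool" where
  "pos_def M \<longleftrightarrow> (\<forall>x. x \<noteq> 0 \<longrightarrow> 0 < x \<bullet> (M *v x))"

definition pos_semidef :: "real^'n^'n \<Rightarrow> bool" where
  "pos_semidef M \<longleftrightarrow> (\<forall>x. 0 \<le> x \<bullet> (M *v x))"

text \<open>A third-order operator \<open>L 1 \<partial>\<^sub>x + L 2 \<partial>\<^sub>x\<^sup>2 + L 3 \<partial>\<^sub>x\<^sup>3\<close> with constant coefficients, linearized
  at one fixed state, is given by its coefficients \<open>L j\<close>; only \<open>j \<in> {1..3}\<close> matters.\<close>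

definition friedrichs_symmetrizable :: "(nat \<Rightarrow> real^'n^'n) \<Rightarrow> bool" where
  "friedrichs_symmetrizable L \<longleftrightarrow>
     (\<exists>A0. symmetric A0 \<and> pos_def A0 \<and> (\<forall>j\<in>{1..3}. symmetric (A0 ** L j)))"

text \<open>Symbols \<open>A\<close>, \<open>B\<close> refer to the form \<open>U\<^sub>t + \<i>\<xi> A(\<xi>) U + B(\<xi>) U = 0\<close> of the
  Fourier-transformed equation. Positive definiteness is required at each \<open>\<xi>\<close>, not uniformly.\<close>

definition symbol_symmetrizer ::
    "(real \<Rightarrow> real^'n^'n) \<Rightarrow> (real \<Rightarrow> real^'n^'n) \<Rightarrow> (real \<Rightarrow> real^'n^'n) \<Rightarrow> bool" where
  "symbol_symmetrizer A B A0 \<longleftrightarrow>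
     smooth A0 \<and>
     (\<forall>\<xi>. symmetric (A0 \<xi>) \<and> pos_def (A0 \<xi>) \<and>
          symmetric (A0 \<xi> ** A \<xi>) \<and> symmetric (A0 \<xi> ** B \<xi>) \<and> pos_semidef (A0 \<xi> ** B \<xi>))"

definition symbol_symmetrizable ::
    "(real \<Rightarrow> real^'n^'n) \<Rightarrow> (real \<Rightarrow> real^'n^'n) \<Rightarrow> bool" where
  "symbol_symmetrizable A B \<longleftrightarrow> (\<exists>A0. symbol_symmetrizer A B A0)"

definition mat22 :: "real \<Rightarrow> real \<Rightarrow> real \<Rightarrow> real \<Rightarrow> real^2^2" where
  "mat22 a b c d = vector [vector [a, b], vector [c, d]]"

definition korteweg_L :: "real \<Rightarrow> real \<Rightarrow> real \<Rightarrow> real \<Rightarrow> nat \<Rightarrow> real^2^2" where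
  "korteweg_L v q \<kappa> \<mu> j =
     (if j = 1 then mat22 0 1 q 0
      else if j = 2 then mat22 0 0 0 (\<mu> / v)
      else if j = 3 then - mat22 0 0 \<kappa> 0
      else 0)"

definition korteweg_beta :: "real \<Rightarrow> real \<Rightarrow> real \<Rightarrow> real" where
  "korteweg_beta q \<kappa> \<xi> = q + \<xi>\<^sup>2 * \<kappa>"

definition korteweg_A :: "real \<Rightarrow> real \<Rightarrow> real \<Rightarrow> real^2^2" where
  "korteweg_A q \<kappa> \<xi> = mat22 0 (-1) (- (q + \<xi>\<^sup>2 * \<kappa>)) 0"

definition korteweg_B :: "real \<Rightarrow> real \<Rightarrow> real \<Rightarrow> real^2^2" where
  "korteweg_B v \<mu> \<xi> = \<xi>\<^sup>2 *\<^sub>R mat22 0 0 0 (\<mu> / v)"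

text \<open>The matrices \<open>korteweg_A\<close>, \<open>korteweg_B\<close> are indeed the symbols of the operator with
  coefficients \<open>korteweg_L\<close>.\<close>

lemma korteweg_symbol:
  "(\<Sum>j=1..3. (\<i> * of_real \<xi>) ^ j * complex_of_real (korteweg_L v q \<kappa> \<mu> j $ r $ c)) =
     - (\<i> * of_real \<xi> * of_real (korteweg_A q \<kappa> \<xi> $ r $ c) + of_real (korteweg_B v \<mu> \<xi> $ r $ c))"
proof -
  have S: "sum f {1..3::nat} = f 1 + f 2 + f 3" for f :: "nat \<Rightarrow> complex"
    by (simp add: numeral_3_eq_3 numeral_2_eq_2)
  consider "r = 1" "c = 1" | "r = 1" "c = 2" | "r = 2" "c = 1" | "r = 2" "c = 2"
    using exhaust_2 by blast
  then show ?thesis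
    unfolding S
    by cases (simp_all add: korteweg_L_def korteweg_A_def korteweg_B_def mat22_def
        power2_eq_square power3_eq_cube algebra_simps)
qed

definition korteweg_symmetrizer ::
    "real \<Rightarrow> real \<Rightarrow> (real \<Rightarrow> real) \<Rightarrow> real \<Rightarrow> real^2^2" where
  "korteweg_symmetrizer q \<kappa> a \<xi> = mat22 (a \<xi>) 0 0 (a \<xi> * inverse (korteweg_beta q \<kappa> \<xi>))"

text \<open>A symbol symmetrizer may be multiplied by any smooth positive scalar function, e.g. by
  \<open>1 / (1 + \<xi>\<^sup>2)\<close>, so pointwise positive definiteness alone gives no uniform lower bound for its
  entries. The following is the normalization that excludes such degenerate factors; it is
  implied by uniform positive definiteness.\<close>

definition bounded_away_from_zero :: "(real \<Rightarrow> 'a::real_normed_vector) \<Rightarrow> bool" where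
  "bounded_away_from_zero f \<longleftrightarrow> (\<exists>c>0. \<forall>\<xi>. c \<le> norm (f \<xi>))"

end

theory Submission
  imports Defs
begin

text \<open>If \<open>A\<^sub>0\<close> has entries \<open>a, b, b, d\<close>, symmetry of \<open>A\<^sub>0 A\<close> says \<open>a = d \<beta>\<close> and symmetry of
  \<open>A\<^sub>0 B\<close> says \<open>\<xi>\<^sup>2 b = 0\<close>. The latter gives \<open>b = 0\<close> except at \<open>\<xi> = 0\<close>, where continuity of \<open>b\<close> is
  needed. In the Friedrichs case the third-order coefficient also forces \<open>d = 0\<close>, contradicting
  definiteness.\<close>

section \<open>Closure properties of smooth functions\<close>

text \<open>A finite-order form of \<open>smooth\<close> that recurses on the derivative of
  \<open>f\<close>, so closure properties follow by induction on \<open>n\<close>, usually with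
  \<open>f\<close> generalized. Order 0 is vacuous.\<close>

primrec differentiable_times :: "nat \<Rightarrow> (real \<Rightarrow> 'a::real_normed_vector) \<Rightarrow> bool" where
  "differentiable_times 0 f \<longleftrightarrow> True"
| "differentiable_times (Suc n) f \<longleftrightarrow>
     (\<forall>x. f differentiable (at x)) \<and> differentiable_times n (\<lambda>x. vector_derivative f (at x))"

lemma differentiable_times_iff:
  "differentiable_times n f \<longleftrightarrow>
     (\<forall>m<n. \<forall>x. ((\<lambda>g t. vector_derivative g (at t)) ^^ m) f differentiable (at x))"
proof (induction n arbitrary: f)
  case (Suc n)
  show ?case
    \<comment> \<open>\<open>All_less_Suc2\<close> splits off \<open>m = 0\<close>, and
      \<open>funpow_Suc_right\<close> lets the first differentiation act directly on
      \<open>f\<close>, which is the shape of the recursion.\<close>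
    unfolding differentiable_times.simps Suc.IH All_less_Suc2 funpow_Suc_right comp_apply funpow_0 ..
qed simp

lemma smooth_iff: "smooth f \<longleftrightarrow> (\<forall>n. differentiable_times n f)"
  by (auto simp: smooth_def differentiable_times_iff)

lemma differentiable_times_pred:
  "differentiable_times (Suc n) f \<Longrightarrow> differentiable_times n f"
  by (induction n arbitrary: f) auto

lemma smooth_imp_differentiable: "smooth f \<Longrightarrow> f differentiable (at x)"
  using differentiable_times.simps(2)[of 0 f] by (simp add: smooth_iff)

text \<open>The induction step of the closure lemmas below: since derivatives are unique, an
  explicit formula \<open>f'\<close> may replace \<open>vector_derivative\<close>.\<close>

lemma differentiable_times_SucI:
  assumes "\<And>x. (f has_vector_derivative f' x) (at x)" and "differentiable_times n f'"
  shows "differentiable_times (Suc n) f"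
proof -
  have "(\<lambda>x. vector_derivative f (at x)) = f'"
    using assms(1) vector_derivative_at by blast
  then show ?thesis
    using assms differentiableI_vector by (simp only: differentiable_times.simps(2)) blast
qed

lemma differentiable_times_SucD:
  assumes "differentiable_times (Suc n) f"
  shows "(f has_vector_derivative vector_derivative f (at x)) (at x)"
  using assms by (simp add: vector_derivative_works)

lemma differentiable_times_const: "differentiable_times n (\<lambda>x. c)"
proof (induction n arbitrary: c)
  case (Suc n)
  then show ?case
    by (intro differentiable_times_SucI[where f' = "\<lambda>x. 0"]) auto
qed simp

lemma differentiable_times_linear:
  assumes h: "bounded_linear h"
  shows "differentiable_times n f \<Longrightarrow> differentiable_times n (\<lambda>x. h (f x))"
proof (induction n arbitrary: f)
  case (Suc n)
  show ?case
    using Suc.prems by (intro differentiable_times_SucI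
        [OF bounded_linear.has_vector_derivative[OF h differentiable_times_SucD] Suc.IH]) auto
qed simp

lemma differentiable_times_add:
  "differentiable_times n f \<Longrightarrow> differentiable_times n g \<Longrightarrow> differentiable_times n (\<lambda>x. f x + g x)"
proof (induction n arbitrary: f g)
  case (Suc n)
  show ?case
    using Suc.prems by (intro differentiable_times_SucI
        [OF has_vector_derivative_add[OF differentiable_times_SucD differentiable_times_SucD] Suc.IH])
      auto
qed simp

text \<open>The product rule turns the derivative into a sum of two terms of the same bilinear form,
  each pairing a function with a derivative. Lowering the order of the undifferentiated factor by
  one makes the induction hypothesis apply to both. Both products of reals and scaling of matrices
  are instances.\<close>

lemma differentiable_times_bilinear:
  assumes h: "bounded_bilinear h"
  shows "differentiable_times n f \<Longrightarrow> differentiable_times n g \<Longrightarrow>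
    differentiable_times n (\<lambda>x. h (f x) (g x))"
proof (induction n arbitrary: f g)
  case (Suc n)
  let ?D = "\<lambda>f x. vector_derivative f (at x)"
  have "differentiable_times n (\<lambda>x. h (f x) (?D g x) + h (?D f x) (g x))"
    using Suc.prems Suc.prems[THEN differentiable_times_pred]
    by (intro differentiable_times_add Suc.IH) simp_all
  moreover have "((\<lambda>x. h (f x) (g x)) has_vector_derivative
      h (f x) (?D g x) + h (?D f x) (g x)) (at x)" for x
    by (rule bounded_bilinear.has_vector_derivative
        [OF h Suc.prems[THEN differentiable_times_SucD]])
  ultimately show ?case
    by (rule differentiable_times_SucI[rotated])
qed simp

text \<open>The derivative of \<open>1/f\<close> is \<open>-(1/f) f' (1/f)\<close>, which contains
  \<open>1/f\<close> itself, but only to order \<open>n\<close>; the induction hypothesis for the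
  same \<open>f\<close> supplies that.\<close>

lemma differentiable_times_inverse:
  fixes f :: "real \<Rightarrow> real"
  assumes nz: "\<And>x. f x \<noteq> 0"
  shows "differentiable_times n f \<Longrightarrow> differentiable_times n (\<lambda>x. inverse (f x))"
proof (induction n)
  case (Suc n)
  let ?D = "\<lambda>x. vector_derivative f (at x)"
  have inv: "differentiable_times n (\<lambda>x. inverse (f x))"
    using Suc differentiable_times_pred by blast
  have "differentiable_times n (\<lambda>x. - (inverse (f x) * ?D x * inverse (f x)))"
    using Suc.prems inv
    by (intro differentiable_times_linear[OF bounded_linear_minus[OF bounded_linear_ident]]
        differentiable_times_bilinear[OF bounded_bilinear_mult]) auto
  moreover have "((\<lambda>x. inverse (f x)) has_vector_derivative
      - (inverse (f x) * ?D x * inverse (f x))) (at x)" for x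
    using DERIV_inverse'[of f "?D x" x UNIV] nz differentiable_times_SucD[OF Suc.prems, of x]
    by (simp add: has_real_derivative_iff_has_vector_derivative)
  ultimately show ?case
    by (rule differentiable_times_SucI[rotated])
qed simp

lemma smooth_const: "smooth (\<lambda>x. c)"
  by (simp add: smooth_iff differentiable_times_const)

lemma smooth_id: "smooth (\<lambda>x. x)"
  unfolding smooth_iff
proof
  show "differentiable_times n (\<lambda>x. x)" for n
    by (cases n)
      (auto simp del: differentiable_times.simps(2)
        intro!: differentiable_times_SucI[where f' = "\<lambda>x. 1"] differentiable_times_const)
qed

lemma smooth_linear: "bounded_linear h \<Longrightarrow> smooth f \<Longrightarrow> smooth (\<lambda>x. h (f x))"
  by (simp add: smooth_iff differentiable_times_linear)

lemma smooth_add: "smooth f \<Longrightarrow> smooth g \<Longrightarrow> smooth (\<lambda>x. f x + g x)"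
  by (simp add: smooth_iff differentiable_times_add)

lemma smooth_bilinear:
  "bounded_bilinear h \<Longrightarrow> smooth f \<Longrightarrow> smooth g \<Longrightarrow> smooth (\<lambda>x. h (f x) (g x))"
  by (simp add: smooth_iff differentiable_times_bilinear)

lemma smooth_inverse:
  fixes f :: "real \<Rightarrow> real"
  shows "smooth f \<Longrightarrow> (\<And>x. f x \<noteq> 0) \<Longrightarrow> smooth (\<lambda>x. inverse (f x))"
  by (simp add: smooth_iff differentiable_times_inverse)

section \<open>Algebra of 2 by 2 matrices\<close>

lemma mat22_nth [simp]:
  "mat22 a b c d $ 1 $ 1 = a" "mat22 a b c d $ 1 $ 2 = b"
  "mat22 a b c d $ 2 $ 1 = c" "mat22 a b c d $ 2 $ 2 = d"
  by (simp_all add: mat22_def)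

lemma mat22_eta: "mat22 (M $ 1 $ 1) (M $ 1 $ 2) (M $ 2 $ 1) (M $ 2 $ 2) = M"
  by (simp add: vec_eq_iff forall_2)

lemma mat22_mult:
  "mat22 a b c d ** mat22 a' b' c' d' =
     mat22 (a * a' + b * c') (a * b' + b * d') (c * a' + d * c') (c * b' + d * d')"
  by (simp add: vec_eq_iff forall_2 matrix_matrix_mult_def sum_2)

lemma mat22_scaleR: "r *\<^sub>R mat22 a b c d = mat22 (r * a) (r * b) (r * c) (r * d)"
  by (simp add: vec_eq_iff forall_2)

lemma mat22_uminus: "- mat22 a b c d = mat22 (- a) (- b) (- c) (- d)"
  by (simp add: vec_eq_iff forall_2)

lemma symmetric_mat22: "symmetric (mat22 a b c d) \<longleftrightarrow> b = c"
  by (auto simp: symmetric_def vec_eq_iff forall_2 transpose_def)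

lemma inner_mat22:
  "x \<bullet> (mat22 a b c d *v x) = a * (x $ 1)\<^sup>2 + (b + c) * (x $ 1) * (x $ 2) + d * (x $ 2)\<^sup>2"
  by (simp add: inner_vec_def matrix_vector_mult_def sum_2 power2_eq_square algebra_simps)

lemma pos_def_mat22_diag: "pos_def (mat22 a 0 0 d) \<longleftrightarrow> 0 < a \<and> 0 < d"
proof
  assume P: "pos_def (mat22 a 0 0 d)"
  show "0 < a \<and> 0 < d"
    \<comment> \<open>The quadratic form at the two coordinate vectors returns the diagonal
      entries.\<close>
    using P[unfolded pos_def_def inner_mat22, rule_format, of "axis 1 1"]
      P[unfolded pos_def_def inner_mat22, rule_format, of "axis 2 1"]
    by (simp add: axis_def vec_eq_iff)
next
  assume ad: "0 < a \<and> 0 < d"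
  have "0 < a * (x $ 1)\<^sup>2 + d * (x $ 2)\<^sup>2" if "x \<noteq> 0" for x :: "real^2"
  proof -
    have "x $ 1 \<noteq> 0 \<or> x $ 2 \<noteq> 0"
      using that by (simp add: vec_eq_iff forall_2)
    then show ?thesis
      using ad by (elim disjE) (simp_all add: add_pos_nonneg add_nonneg_pos)
  qed
  then show "pos_def (mat22 a 0 0 d)"
    by (simp add: pos_def_def inner_mat22)
qed

lemma pos_semidef_mat22_diag: "0 \<le> a \<Longrightarrow> 0 \<le> d \<Longrightarrow> pos_semidef (mat22 a 0 0 d)"
  by (simp add: pos_semidef_def inner_mat22)

section \<open>Positivity of \<beta> and failure of Friedrichs symmetrizability\<close>

lemma korteweg_beta_ge:
  assumes "\<kappa> > 0"
  shows "korteweg_beta q \<kappa> \<xi> \<ge> q"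
  using assms by (simp add: korteweg_beta_def)

lemma korteweg_beta_pos:
  assumes "q > 0" "\<kappa> > 0"
  shows "korteweg_beta q \<kappa> \<xi> > 0"
  using korteweg_beta_ge[of \<kappa> q \<xi>] assms by linarith

lemma not_friedrichs_symmetrizable_korteweg:
  assumes "v > 0" "\<kappa> > 0" "\<mu> > 0"
  shows "\<not> friedrichs_symmetrizable (korteweg_L v q \<kappa> \<mu>)"
proof
  assume "friedrichs_symmetrizable (korteweg_L v q \<kappa> \<mu>)"
  then obtain M where M: "symmetric M" "pos_def M"
    and L: "\<And>j. j \<in> {1..3} \<Longrightarrow> symmetric (M ** korteweg_L v q \<kappa> \<mu> j)"
    unfolding friedrichs_symmetrizable_def by blast
  obtain a b c d where eq: "M = mat22 a b c d"
    using mat22_eta by metis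
  \<comment> \<open>The off-diagonal entries of \<open>M ** L 2\<close> are
    \<open>b * (\<mu> / v)\<close> and \<open>0\<close>; those of \<open>M ** L 3\<close> are
    \<open>0\<close> and \<open>- (d * \<kappa>)\<close>. Together they leave \<open>M\<close> with
    a zero second diagonal entry.\<close>
  have "b = 0"
    using L[of 2] assms by (simp add: eq korteweg_L_def mat22_mult symmetric_mat22)
  moreover have "d = 0"
    using L[of 3] assms by (simp add: eq korteweg_L_def mat22_mult mat22_uminus symmetric_mat22)
  ultimately show False
    using M by (simp add: eq symmetric_mat22 pos_def_mat22_diag)
qed

section \<open>The diagonal family consists of symmetrizers\<close>

lemma smooth_korteweg_symmetrizer:
  assumes "q > 0" "\<kappa> > 0" "smooth a"
  shows "smooth (korteweg_symmetrizer q \<kappa> a)"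
proof -
  have "smooth (korteweg_beta q \<kappa>)"
    unfolding korteweg_beta_def[abs_def] power2_eq_square
    by (intro smooth_add smooth_bilinear[OF bounded_bilinear_mult] smooth_const smooth_id)
  moreover have "korteweg_beta q \<kappa> \<xi> \<noteq> 0" for \<xi>
    using korteweg_beta_pos[of q \<kappa> \<xi>] assms by simp
  \<comment> \<open>Writing the matrix as a combination of constant matrices with scalar
    coefficients reduces its smoothness to that of \<open>a\<close> and of the inverse of
    \<beta>.\<close>
  ultimately have "smooth (\<lambda>\<xi>. a \<xi> *\<^sub>R
      (mat22 1 0 0 0 + inverse (korteweg_beta q \<kappa> \<xi>) *\<^sub>R mat22 0 0 0 1))"
    using assms
    by (intro smooth_bilinear[OF bounded_bilinear_scaleR] smooth_add smooth_inverse smooth_const)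
  moreover have "korteweg_symmetrizer q \<kappa> a =
      (\<lambda>\<xi>. a \<xi> *\<^sub>R (mat22 1 0 0 0 + inverse (korteweg_beta q \<kappa> \<xi>) *\<^sub>R mat22 0 0 0 1))"
    by (simp add: fun_eq_iff korteweg_symmetrizer_def vec_eq_iff forall_2)
  ultimately show ?thesis
    by simp
qed

text \<open>Multiplying \<beta> by its inverse makes both off-diagonal entries of the product with
  \<open>korteweg_A\<close> equal to \<open>- a \<xi>\<close>. The product with
  \<open>korteweg_B\<close> is diagonal with entries \<open>0\<close> and a nonnegative multiple of
  the square of \<xi>.\<close>

lemma symbol_symmetrizer_korteweg_symmetrizer:
  assumes "v > 0" "q > 0" "\<kappa> > 0" "\<mu> > 0" "smooth a" "\<And>\<xi>. a \<xi> > 0"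
  shows "symbol_symmetrizer (korteweg_A q \<kappa>) (korteweg_B v \<mu>) (korteweg_symmetrizer q \<kappa> a)"
proof -
  have \<beta>: "0 < korteweg_beta q \<kappa> \<xi>" for \<xi>
    using korteweg_beta_pos assms by blast
  note [simp] = less_imp_neq[OF \<beta>, symmetric]
  note [simp] = less_imp_le[OF \<beta>] less_imp_le[OF assms(6)]
  have "korteweg_A q \<kappa> \<xi> = mat22 0 (- 1) (- korteweg_beta q \<kappa> \<xi>) 0" for \<xi>
    by (simp add: korteweg_A_def korteweg_beta_def)
  then show ?thesis
    using assms \<beta> smooth_korteweg_symmetrizer
    by (auto simp: symbol_symmetrizer_def korteweg_symmetrizer_def korteweg_B_def
        mat22_scaleR mat22_mult symmetric_mat22 pos_def_mat22_diag
        intro!: pos_semidef_mat22_diag)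
qed

section \<open>Every symbol symmetrizer is diagonal of this form\<close>

lemma bounded_linear_matrix_nth: "bounded_linear (\<lambda>M::real^'n^'m. M $ i $ j)"
  by (rule bounded_linear_compose[OF bounded_linear_vec_nth bounded_linear_vec_nth])

text \<open>For the frequency 0, where \<open>korteweg_B\<close> vanishes and its symmetry condition
  is empty: the limit at 0 is 0, and continuity identifies it with the value.\<close>

lemma continuous_eq_0_at_0:
  fixes f :: "real \<Rightarrow> real"
  assumes "isCont f 0" "\<And>x. x \<noteq> 0 \<Longrightarrow> f x = 0"
  shows "f x = 0"
proof (cases "x = 0")
  case True
  have "f \<midarrow>0\<rightarrow> 0"
    using assms(2) by (intro tendsto_eventually) (auto simp: eventually_at_filter)
  then show ?thesis
    using assms(1) True LIM_unique unfolding isCont_def by blast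
qed (use assms in auto)

lemma symbol_symmetrizer_kortewegD:
  assumes "v > 0" "q > 0" "\<kappa> > 0" "\<mu> > 0"
    and S: "symbol_symmetrizer (korteweg_A q \<kappa>) (korteweg_B v \<mu>) A0"
  obtains a where "smooth a" "\<And>\<xi>. a \<xi> > 0" "A0 = korteweg_symmetrizer q \<kappa> a"
proof -
  \<comment> \<open>The required scalar function is the upper left entry of \<open>A0\<close>;
    smoothness passes to entries because taking an entry is bounded linear.\<close>
  define a b c d where defs: "a = (\<lambda>\<xi>. A0 \<xi> $ 1 $ 1)" "b = (\<lambda>\<xi>. A0 \<xi> $ 1 $ 2)"
    "c = (\<lambda>\<xi>. A0 \<xi> $ 2 $ 1)" "d = (\<lambda>\<xi>. A0 \<xi> $ 2 $ 2)"
  have eq: "A0 \<xi> = mat22 (a \<xi>) (b \<xi>) (c \<xi>) (d \<xi>)" for \<xi>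
    by (simp add: defs mat22_eta)
  have SD: "symmetric (A0 \<xi>)" "pos_def (A0 \<xi>)"
      "symmetric (A0 \<xi> ** korteweg_A q \<kappa> \<xi>)" "symmetric (A0 \<xi> ** korteweg_B v \<mu> \<xi>)" for \<xi>
    using S unfolding symbol_symmetrizer_def by blast+
  have "smooth A0"
    using S unfolding symbol_symmetrizer_def by blast
  then have sm: "smooth a" "smooth b"
    unfolding defs by (rule smooth_linear[OF bounded_linear_matrix_nth])+
  have bc: "c \<xi> = b \<xi>" for \<xi>
    using SD(1)[of \<xi>] unfolding eq symmetric_mat22 by (rule sym)
  have ad: "a \<xi> = d \<xi> * korteweg_beta q \<kappa> \<xi>" for \<xi>
    using SD(3)[of \<xi>] unfolding eq korteweg_A_def korteweg_beta_def mat22_mult symmetric_mat22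
    by (simp add: algebra_simps)
  \<comment> \<open>The upper right entry of the product with \<open>korteweg_B\<close> is
    \<open>b \<xi>\<close> times a factor that is nonzero away from 0, while the lower left entry is
    0.\<close>
  have "b \<xi> = 0" if "\<xi> \<noteq> 0" for \<xi>
    using SD(4)[of \<xi>] that assms
    unfolding eq korteweg_B_def mat22_mult mat22_scaleR symmetric_mat22 by simp
  moreover have "isCont b 0"
    by (rule differentiable_imp_continuous_within[OF smooth_imp_differentiable[OF sm(2)]])
  ultimately have b: "b \<xi> = 0" for \<xi>
    by (rule continuous_eq_0_at_0[of b, rotated])
  have pos: "a \<xi> > 0" for \<xi>
    using SD(2)[of \<xi>] unfolding eq bc b pos_def_mat22_diag ..
  have "A0 = korteweg_symmetrizer q \<kappa> a"
  proof
    show "A0 \<xi> = korteweg_symmetrizer q \<kappa> a \<xi>" for \<xi>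
      using korteweg_beta_pos[of q \<kappa> \<xi>] assms
      by (simp add: eq bc b korteweg_symmetrizer_def ad mult.assoc)
  qed
  then show thesis
    by (rule that[OF sm(1) pos])
qed

section \<open>Uniform lower bounds\<close>

text \<open>The norm is at most the sum of the absolute entries, and \<beta> \<ge> q bounds the
  inverse of \<beta> by that of \<open>q\<close>, so the constant does not depend on \<xi>.\<close>

lemma norm_korteweg_symmetrizer_le:
  assumes "q > 0" "\<kappa> > 0" "a \<xi> > 0"
  shows "norm (korteweg_symmetrizer q \<kappa> a \<xi>) \<le> a \<xi> * (1 + inverse q)"
proof -
  have "norm (korteweg_symmetrizer q \<kappa> a \<xi>) \<le> (\<Sum>i\<in>UNIV. norm (korteweg_symmetrizer q \<kappa> a \<xi> $ i))"
    unfolding norm_vec_def by (simp add: L2_set_le_sum)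
  also have "\<dots> \<le> (\<Sum>i\<in>UNIV. \<Sum>j\<in>UNIV. \<bar>korteweg_symmetrizer q \<kappa> a \<xi> $ i $ j\<bar>)"
    by (intro sum_mono norm_le_l1_cart)
  also have "\<dots> = a \<xi> + a \<xi> * inverse (korteweg_beta q \<kappa> \<xi>)"
    using korteweg_beta_pos[of q \<kappa> \<xi>] assms by (simp add: sum_2 korteweg_symmetrizer_def)
  also have "\<dots> \<le> a \<xi> + a \<xi> * inverse q"
    using korteweg_beta_ge[of \<kappa> q \<xi>] assms by (simp add: le_imp_inverse_le)
  finally show ?thesis
    by (simp add: algebra_simps)
qed

lemma norm_korteweg_symmetrizer_ge: "a \<xi> \<le> norm (korteweg_symmetrizer q \<kappa> a \<xi>)"
proof -
  have "a \<xi> \<le> \<bar>korteweg_symmetrizer q \<kappa> a \<xi> $ 1 $ 1\<bar>"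
    by (simp add: korteweg_symmetrizer_def)
  also have "\<dots> \<le> norm (korteweg_symmetrizer q \<kappa> a \<xi> $ 1)"
    by (rule component_le_norm_cart)
  also have "\<dots> \<le> norm (korteweg_symmetrizer q \<kappa> a \<xi>)"
    by (rule Finite_Cartesian_Product.norm_nth_le)
  finally show ?thesis .
qed

text \<open>The norm of the matrix lies between \<open>a \<xi>\<close> and
  \<open>(1 + inverse q) * a \<xi>\<close>, so lower bounds transfer in both directions, up to that
  constant factor.\<close>

lemma bounded_away_korteweg_symmetrizer_iff:
  assumes "q > 0" "\<kappa> > 0" and pos: "\<And>\<xi>. a \<xi> > 0"
  shows "bounded_away_from_zero (korteweg_symmetrizer q \<kappa> a) \<longleftrightarrow> (\<exists>a0>0. \<forall>\<xi>. a \<xi> \<ge> a0)"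
proof
  assume "bounded_away_from_zero (korteweg_symmetrizer q \<kappa> a)"
  then obtain c where c: "c > 0" "\<And>\<xi>. c \<le> norm (korteweg_symmetrizer q \<kappa> a \<xi>)"
    unfolding bounded_away_from_zero_def by blast
  have r: "1 + inverse q > 0"
    using assms by (simp add: add_pos_pos)
  have "c \<le> a \<xi> * (1 + inverse q)" for \<xi>
    using c(2)[of \<xi>] norm_korteweg_symmetrizer_le[of q \<kappa> a \<xi>] assms(1,2) pos[of \<xi>] by linarith
  then have "\<forall>\<xi>. a \<xi> \<ge> c / (1 + inverse q)"
    using r by (simp only: pos_divide_le_eq) blast
  then show "\<exists>a0>0. \<forall>\<xi>. a \<xi> \<ge> a0"
    using c(1) r divide_pos_pos by blast
next
  assume "\<exists>a0>0. \<forall>\<xi>. a \<xi> \<ge> a0"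
  then show "bounded_away_from_zero (korteweg_symmetrizer q \<kappa> a)"
    unfolding bounded_away_from_zero_def by (meson norm_korteweg_symmetrizer_ge order_trans)
qed

text \<open>The classification comes in two versions because a symbol symmetrizer only forces
  \<open>a\<close> to be positive at each point; a uniform bound \<open>a0\<close> corresponds to
  the normalization \<open>bounded_away_from_zero\<close>.\<close>

theorem lemma4p2:
  fixes v q \<kappa> \<mu> :: real
  assumes "v > 0" and "q > 0" and "\<kappa> > 0" and "\<mu> > 0"
  shows "symbol_symmetrizable (korteweg_A q \<kappa>) (korteweg_B v \<mu>)
    \<and> \<not> friedrichs_symmetrizable (korteweg_L v q \<kappa> \<mu>)
    \<and> (\<forall>\<xi>. korteweg_beta q \<kappa> \<xi> > 0)
    \<and> (\<forall>A0. symbol_symmetrizer (korteweg_A q \<kappa>) (korteweg_B v \<mu>) A0 \<longleftrightarrow>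
          (\<exists>a. smooth a \<and> (\<forall>\<xi>. a \<xi> > 0) \<and> A0 = korteweg_symmetrizer q \<kappa> a))
    \<and> (\<forall>A0. symbol_symmetrizer (korteweg_A q \<kappa>) (korteweg_B v \<mu>) A0 \<and> bounded_away_from_zero A0 \<longleftrightarrow>
          (\<exists>a a0. smooth a \<and> a0 > 0 \<and> (\<forall>\<xi>. a \<xi> \<ge> a0) \<and> A0 = korteweg_symmetrizer q \<kappa> a))"
proof (intro conjI allI)
  note sym = symbol_symmetrizer_korteweg_symmetrizer[OF assms]
  show "symbol_symmetrizable (korteweg_A q \<kappa>) (korteweg_B v \<mu>)"
    \<comment> \<open>The witness is the member of the family with \<open>a\<close> constantly
      1.\<close>
    unfolding symbol_symmetrizable_def using sym[OF smooth_const[of 1]] by auto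
  show "\<not> friedrichs_symmetrizable (korteweg_L v q \<kappa> \<mu>)"
    using assms by (intro not_friedrichs_symmetrizable_korteweg)
  show "korteweg_beta q \<kappa> \<xi> > 0" for \<xi>
    using assms by (intro korteweg_beta_pos)
  show iff: "symbol_symmetrizer (korteweg_A q \<kappa>) (korteweg_B v \<mu>) A0 \<longleftrightarrow>
      (\<exists>a. smooth a \<and> (\<forall>\<xi>. a \<xi> > 0) \<and> A0 = korteweg_symmetrizer q \<kappa> a)" for A0
  proof
    assume "symbol_symmetrizer (korteweg_A q \<kappa>) (korteweg_B v \<mu>) A0"
    then obtain a where "smooth a" "\<And>\<xi>. a \<xi> > 0" "A0 = korteweg_symmetrizer q \<kappa> a"
      using symbol_symmetrizer_kortewegD[OF assms] by blast
    then show "\<exists>a. smooth a \<and> (\<forall>\<xi>. a \<xi> > 0) \<and> A0 = korteweg_symmetrizer q \<kappa> a"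
      by blast
  qed (use sym in blast)
  show "symbol_symmetrizer (korteweg_A q \<kappa>) (korteweg_B v \<mu>) A0 \<and> bounded_away_from_zero A0 \<longleftrightarrow>
      (\<exists>a a0. smooth a \<and> a0 > 0 \<and> (\<forall>\<xi>. a \<xi> \<ge> a0) \<and> A0 = korteweg_symmetrizer q \<kappa> a)"
    (is "?L \<longleftrightarrow> ?R") for A0
  proof
    assume L: ?L
    then obtain a where a: "smooth a" "\<And>\<xi>. a \<xi> > 0" "A0 = korteweg_symmetrizer q \<kappa> a"
      using symbol_symmetrizer_kortewegD[OF assms] by blast
    moreover obtain a0 where "a0 > 0" "\<forall>\<xi>. a \<xi> \<ge> a0"
      using L bounded_away_korteweg_symmetrizer_iff[OF assms(2,3), of a] a by auto
    ultimately show ?R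
      by (intro exI[of _ a] exI[of _ a0]) simp
  next
    assume ?R
    then obtain a a0 where a: "smooth a" "a0 > 0" "\<forall>\<xi>. a \<xi> \<ge> a0"
        "A0 = korteweg_symmetrizer q \<kappa> a"
      by (elim exE conjE)
    then have pos: "a \<xi> > 0" for \<xi>
      using less_le_trans by (metis (no_types))
    have "bounded_away_from_zero A0"
      unfolding a(4) bounded_away_korteweg_symmetrizer_iff[OF assms(2,3) pos]
      by (intro exI[of _ a0] conjI a(2,3))
    then show ?L
      using sym[OF a(1) pos] a(4) by simp
  qed
qed

end
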